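(* Let $N\in\mathbb{N}$, let $\Omega\subseteq\mathbb{R}^N$, let $V(\Omega)\subseteq L^2(\Omega)$ be a vector space of functions, let $\mathfrak{L}=\mathcal{P}_{fin}(V(\Omega))$ be the set of finite subsets of $V(\Omega)$, and let $\mathcal{U}$ be a fine ultrafilter on $\mathfrak{L}$. Let $J:V(\Omega)\to\mathbb{R}$ be an operator that is continuous and coercive on finite dimensional spaces. Then the operator $\widetilde{J}:V_\Lambda(\Omega)\to\mathbb{R}^\ast$ has a minimum point. Moreover, if $J$ itself has a minimizer $u\in V(\Omega)$, then $u^\ast$ is a minimizer of $\widetilde{J}$.
   Context: $\mathfrak{L}$ is assumed infinite (i.e. $V(\Omega)\neq\{0\}$). The ultrafilter $\mathcal{U}$ on $\mathfrak{L}$ is fine: for every $\lambda\in\mathfrak{L}$, $\{\mu\in\mathfrak{L}\mid\lambda\subseteq\mu\}\in\mathcal{U}$. "Eventually" means: for all $\lambda$ in some set of $\mathcal{U}$. $\mathbb{R}^\ast$ is the ordered field of $\Lambda$-limits $\lim_{\lambda\uparrow\Lambda}r_\lambda$ of families $(r_\lambda)_{\lambda\in\mathfrak{L}}$ of reals, i.e. the ultrapower $\mathbb{R}^{\mathfrak{L}}/\mathcal{U}$: two families have the same limit iff they are eventually equal, and $\lim_{\lambda\uparrow\Lambda}r_\lambda\le\lim_{\lambda\uparrow\Lambda}s_\lambda$ iff $r_\lambda\le s_\lambda$ eventually. Similarly, for a family $(u_\lambda)_{\lambda\in\mathfrak{L}}$ in $V(\Omega)$, $\lim_{\lambda\uparrow\Lambda}u_\lambda$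 denotes its $\Lambda$-limit (an internal function, namely $(\lim_{\lambda\uparrow\Lambda} u_\lambda)(\lim_{\lambda\uparrow\Lambda} x_\lambda)=\lim_{\lambda\uparrow\Lambda}u_\lambda(x_\lambda)$ for $x_\lambda\in\Omega$); two families have the same limit iff they are eventually equal, so it may be identified with the class of $(u_\lambda)$ in the ultrapower $V(\Omega)^{\mathfrak{L}}/\mathcal{U}$. For $u\in V(\Omega)$, $u^\ast$ is the limit of the constant family $u_\lambda=u$. For $\lambda\in\mathfrak{L}$, $V_\lambda(\Omega)=\mathrm{Span}(\lambda)$, a finite dimensional subspace of $V(\Omega)$. The space of ultrafunctions generated by $V(\Omega)$ is $$V_\Lambda(\Omega)=\Big\{\lim_{\lambda\uparrow\Lambda}u_\lambda\ \Big|\ u_\lambda\in V_\lambda(\Omega)\text{ for all }\lambda\in\mathfrak{L}\Big\}.$$ $\widetilde{J}$ is the restriction to $V_\Lambda(\Omega)$ of the natural extension of $J$: $\widetilde{J}(\lim_{\lambda\uparrow\Lambda}u_\lambda)=\lim_{\lambda\uparrow\Lambda}J(u_\lambda)$. "Continuous and coercive on finite dimensional spaces" means: for every finite dimensional subspace $W\subseteq V(\Omega)$ (with its norm topology), $J|_W$ is continuous and $J(w)\to+\infty$ as $\|w\|\to\infty$ in $W$. A minimizer (minimum point) of $\widetilde{J}$ is $u\in V_\Lambda(\Omega)$ with $\widetilde{J}(u)\le\widetilde{J}(v)$ for all $v\in V_\Lambda(\Omega)$. *)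

theory Defs
  imports "HOL-Analysis.Analysis" "HOL-Library.Function_Algebras"
begin

subsection \<open>Spaces of real functions\<close>

text \<open>Real functions form a real vector space under the pointwise operations, so that
  \<^const>\<open>subspace\<close> and \<^const>\<open>span\<close> apply to sets of functions.\<close>

instantiation "fun" :: (type, real_vector) real_vector
begin

definition scaleR_fun :: "real \<Rightarrow> ('a \<Rightarrow> 'b) \<Rightarrow> 'a \<Rightarrow> 'b"
  where "scaleR_fun c f = (\<lambda>x. c *\<^sub>R f x)"

instance
  by standard (auto simp: scaleR_fun_def fun_eq_iff scaleR_add_right scaleR_add_left)

end

text \<open>A function on \<open>\<Omega>\<close> is represented by its extension by zero. Functions are not identified
  when they agree almost everywhere.\<close>

definition square_integrable_on :: "(real ^ 'n) set \<Rightarrow> (real ^ 'n \<Rightarrow> real) set"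
  where "square_integrable_on \<Omega> =
    {f. f \<in> borel_measurable (lebesgue_on \<Omega>) \<and> integrable (lebesgue_on \<Omega>) (\<lambda>x. (f x)\<^sup>2) \<and>
        (\<forall>x. x \<notin> \<Omega> \<longrightarrow> f x = 0)}"

subsection \<open>Continuity and coercivity on finite dimensional subspaces\<close>

definition norm_on :: "'v::real_vector set \<Rightarrow> ('v \<Rightarrow> real) \<Rightarrow> bool"
  where "norm_on W \<nu> \<longleftrightarrow>
    (\<forall>v\<in>W. 0 \<le> \<nu> v \<and> (\<nu> v = 0 \<longleftrightarrow> v = 0)) \<and>
    (\<forall>c. \<forall>v\<in>W. \<nu> (c *\<^sub>R v) = \<bar>c\<bar> * \<nu> v) \<and>
    (\<forall>v\<in>W. \<forall>w\<in>W. \<nu> (v + w) \<le> \<nu> v + \<nu> w)"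

text \<open>A finite dimensional space carries norms, and they are all equivalent: they
  induce the same topology and the same sets of large vectors. Hence it does not matter which one is
  used below, and requiring the properties for some norm is the same as requiring them for all.
  The \<open>L\<^sup>2\<close> norm is not hard-wired, as it is only a seminorm if \<open>V\<close> contains distinct
  functions that agree almost everywhere.\<close>

definition continuous_coercive_findim :: "'v::real_vector set \<Rightarrow> ('v \<Rightarrow> real) \<Rightarrow> bool"
  where "continuous_coercive_findim V J \<longleftrightarrow>
    (\<forall>W. W \<subseteq> V \<and> subspace W \<and> (\<exists>B. finite B \<and> span B = W) \<longrightarrow>
      (\<exists>\<nu>. norm_on W \<nu> \<and>
        (\<forall>v\<in>W. \<forall>e>0. \<exists>d>0. \<forall>w\<in>W. \<nu> (w - v) < d \<longrightarrow> \<bar>J w - J v\<bar> < e) \<and>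
        filterlim J at_top (inf (filtercomap \<nu> at_top) (principal W))))"

subsection \<open>Fine ultrafilters and limits along them\<close>

text \<open>An ultrafilter on \<open>I\<close> is represented by the filter it generates on the whole type;
  \<open>{i \<in> I. P i}\<close> belongs to the ultrafilter iff \<^term>\<open>eventually P U\<close>.\<close>

definition ultrafilter_on :: "'i set \<Rightarrow> 'i filter \<Rightarrow> bool"
  where "ultrafilter_on I U \<longleftrightarrow>
    U \<noteq> bot \<and> (\<forall>\<^sub>F i in U. i \<in> I) \<and>
    (\<forall>P. (\<forall>\<^sub>F i in U. P i) \<or> (\<forall>\<^sub>F i in U. \<not> P i))"

definition fine_ultrafilter :: "'v set \<Rightarrow> 'v set filter \<Rightarrow> bool"
  where "fine_ultrafilter V U \<longleftrightarrow>
    ultrafilter_on (Fpow V) U \<and> (\<forall>l\<in>Fpow V. \<forall>\<^sub>F m in U. m \<in> Fpow V \<and> l \<subseteq> m)"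

text \<open>The limit of a family in \<open>A\<close> indexed by \<open>I\<close> is its class in the ultrapower of \<open>A\<close>, which
  consists of the families in \<open>A\<close> that eventually agree with it.\<close>

definition Lambda_lim :: "'i set \<Rightarrow> 'i filter \<Rightarrow> 'b set \<Rightarrow> ('i \<Rightarrow> 'b) \<Rightarrow> ('i \<Rightarrow> 'b) set"
  where "Lambda_lim I U A r = {s \<in> I \<rightarrow>\<^sub>E A. \<forall>\<^sub>F i in U. s i = r i}"

text \<open>The order on the hyperreals, i.e. on the limits of real families.\<close>

definition hyper_le :: "'i filter \<Rightarrow> ('i \<Rightarrow> real) set \<Rightarrow> ('i \<Rightarrow> real) set \<Rightarrow> bool"
  where "hyper_le U X Y \<longleftrightarrow> (\<exists>r\<in>X. \<exists>s\<in>Y. \<forall>\<^sub>F i in U. r i \<le> s i)"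

lemma Lambda_lim_restrict_mem:
  assumes "ultrafilter_on I U" and "\<And>i. i \<in> I \<Longrightarrow> r i \<in> A"
  shows "restrict r I \<in> Lambda_lim I U A r"
  using assms by (auto simp: Lambda_lim_def ultrafilter_on_def elim: eventually_mono)

lemma Lambda_lim_eq_iff:
  assumes "ultrafilter_on I U" and "\<And>i. i \<in> I \<Longrightarrow> r i \<in> A"
  shows "Lambda_lim I U A r = Lambda_lim I U A s \<longleftrightarrow> (\<forall>\<^sub>F i in U. r i = s i)"
proof
  assume "Lambda_lim I U A r = Lambda_lim I U A s"
  then have "restrict r I \<in> Lambda_lim I U A s"
    using Lambda_lim_restrict_mem[of I U r A] assms by simp
  then have "\<forall>\<^sub>F i in U. restrict r I i = s i"
    by (simp add: Lambda_lim_def)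
  moreover have "\<forall>\<^sub>F i in U. i \<in> I"
    using assms(1) by (simp add: ultrafilter_on_def)
  ultimately show "\<forall>\<^sub>F i in U. r i = s i"
    by eventually_elim simp
next
  assume rs: "\<forall>\<^sub>F i in U. r i = s i"
  have "(\<forall>\<^sub>F i in U. t i = r i) \<longleftrightarrow> (\<forall>\<^sub>F i in U. t i = s i)" for t
    using rs by (intro eventually_cong) (auto elim: eventually_mono)
  then show "Lambda_lim I U A r = Lambda_lim I U A s"
    by (simp add: Lambda_lim_def)
qed

lemma hyper_le_Lambda_lim_iff:
  assumes "ultrafilter_on I U"
  shows "hyper_le U (Lambda_lim I U UNIV r) (Lambda_lim I U UNIV s) \<longleftrightarrow>
    (\<forall>\<^sub>F i in U. r i \<le> s i)"
proof
  assume "hyper_le U (Lambda_lim I U UNIV r) (Lambda_lim I U UNIV s)"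
  then obtain r' s' where "\<forall>\<^sub>F i in U. r' i = r i" "\<forall>\<^sub>F i in U. s' i = s i"
    and "\<forall>\<^sub>F i in U. r' i \<le> s' i"
    by (auto simp: hyper_le_def Lambda_lim_def)
  then show "\<forall>\<^sub>F i in U. r i \<le> s i"
    by eventually_elim simp
next
  assume rs: "\<forall>\<^sub>F i in U. r i \<le> s i"
  have "\<forall>\<^sub>F i in U. i \<in> I"
    using assms by (simp add: ultrafilter_on_def)
  with rs have "\<forall>\<^sub>F i in U. restrict r I i \<le> restrict s I i"
    by eventually_elim simp
  then show "hyper_le U (Lambda_lim I U UNIV r) (Lambda_lim I U UNIV s)"
    unfolding hyper_le_def
    by (meson Lambda_lim_restrict_mem[OF assms] UNIV_I)
qed

subsection \<open>Ultrafunctions\<close>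

definition ultrafunctions ::
    "'v::real_vector set \<Rightarrow> 'v set filter \<Rightarrow> ('v set \<Rightarrow> 'v) set set"
  where "ultrafunctions V U =
    {Lambda_lim (Fpow V) U V u | u. \<forall>l\<in>Fpow V. u l \<in> span l}"

definition star_embed :: "'v set \<Rightarrow> 'v set filter \<Rightarrow> 'v \<Rightarrow> ('v set \<Rightarrow> 'v) set"
  where "star_embed V U u = Lambda_lim (Fpow V) U V (\<lambda>_. u)"

text \<open>The union is over the representatives of the class \<open>X\<close>, all of which contribute the same
  limit.\<close>

definition natural_ext ::
    "'v set \<Rightarrow> 'v set filter \<Rightarrow> ('v \<Rightarrow> real) \<Rightarrow> ('v set \<Rightarrow> 'v) set \<Rightarrow> ('v set \<Rightarrow> real) set"
  where "natural_ext V U J X = (\<Union>u\<in>X. Lambda_lim (Fpow V) U UNIV (\<lambda>l. J (u l)))"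

lemma natural_ext_Lambda_lim:
  assumes "ultrafilter_on (Fpow V) U" and "\<And>l. l \<in> Fpow V \<Longrightarrow> u l \<in> V"
  shows "natural_ext V U J (Lambda_lim (Fpow V) U V u) =
    Lambda_lim (Fpow V) U UNIV (\<lambda>l. J (u l))"
proof -
  have "Lambda_lim (Fpow V) U UNIV (\<lambda>l. J (v l)) = Lambda_lim (Fpow V) U UNIV (\<lambda>l. J (u l))"
    if "v \<in> Lambda_lim (Fpow V) U V u" for v
    using that assms(1)
    by (subst Lambda_lim_eq_iff) (auto simp: Lambda_lim_def elim: eventually_mono)
  moreover have "Lambda_lim (Fpow V) U V u \<noteq> {}"
    using Lambda_lim_restrict_mem[of "Fpow V" U u V] assms by auto
  ultimately show ?thesis
    by (simp add: natural_ext_def)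
qed

definition is_minimizer :: "('b \<Rightarrow> 'b \<Rightarrow> bool) \<Rightarrow> ('a \<Rightarrow> 'b) \<Rightarrow> 'a set \<Rightarrow> 'a \<Rightarrow> bool"
  where "is_minimizer le F S u \<longleftrightarrow> u \<in> S \<and> (\<forall>v\<in>S. le (F u) (F v))"

end

theory Submission
  imports Defs
begin

text \<open>Balls of a finite dimensional space are compact, so a continuous coercive \<open>J\<close> attains its
  minimum on each \<open>span l\<close>. The limit of a family of such minimizers minimizes the extension
  of \<open>J\<close>, because the inequality holds for every index \<open>l\<close>. For the second claim, fineness
  yields \<open>u \<in> span l\<close> eventually, so \<open>u\<^sup>*\<close> is an ultrafunction.\<close>

subsection \<open>Norms on finite dimensional subspaces\<close>

lemma norm_on_subset: "norm_on W \<nu> \<Longrightarrow> W' \<subseteq> W \<Longrightarrow> norm_on W' \<nu>"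
  unfolding norm_on_def by (meson subsetD)

context
  fixes W :: "'v::real_vector set" and \<nu>
  assumes W: "subspace W" and \<nu>: "norm_on W \<nu>"
begin

lemma norm_on_nonneg: "v \<in> W \<Longrightarrow> 0 \<le> \<nu> v"
  and norm_on_eq_0: "v \<in> W \<Longrightarrow> \<nu> v = 0 \<longleftrightarrow> v = 0"
  and norm_on_scaleR: "v \<in> W \<Longrightarrow> \<nu> (c *\<^sub>R v) = \<bar>c\<bar> * \<nu> v"
  and norm_on_triangle: "v \<in> W \<Longrightarrow> w \<in> W \<Longrightarrow> \<nu> (v + w) \<le> \<nu> v + \<nu> w"
  using \<nu> by (auto simp: norm_on_def)

lemma norm_on_minus: "v \<in> W \<Longrightarrow> \<nu> (- v) = \<nu> v"
  using norm_on_scaleR[of v "-1"] by simp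

lemma norm_on_triangle_sub: "v \<in> W \<Longrightarrow> w \<in> W \<Longrightarrow> \<nu> v \<le> \<nu> (w - v) + \<nu> w"
  using norm_on_triangle[of "v - w" w] norm_on_minus[of "w - v"] W
  by (simp add: subspace_diff)

end

text \<open>The norm is not that of a type class, so the library's Heine-Borel theorem does not apply.\<close>

lemma norm_on_span_bounded_subseq:
  fixes x :: "nat \<Rightarrow> 'v::real_vector"
  assumes "finite B" and "norm_on (span B) \<nu>"
    and "\<And>n. x n \<in> span B" and "\<And>n. \<nu> (x n) \<le> R"
  shows "\<exists>a\<in>span B. \<exists>r. strict_mono r \<and> (\<lambda>n. \<nu> (x (r n) - a)) \<longlonglongrightarrow> 0"
  using assms
proof (induction B arbitrary: x R rule: finite_induct)
  case empty
  then have "x n = 0" for n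
    by simp
  moreover have "\<nu> 0 = 0"
    using empty by (simp add: norm_on_def)
  ultimately show ?case
    using strict_mono_id by auto
next
  case (insert b B)
  let ?W = "span (insert b B)"
  have sub: "span B \<subseteq> ?W"
    by (simp add: span_mono subset_insertI)
  have nB: "norm_on (span B) \<nu>"
    using insert.prems(1) sub by (rule norm_on_subset)
  note IH = insert.IH[OF nB]
  note norm = subspace_span[of "insert b B"] insert.prems(1)
  note tri = norm_on_triangle[OF norm] and scale = norm_on_scaleR[OF norm]
    and nonneg = norm_on_nonneg[OF norm] and min = norm_on_minus[OF norm]
  show ?case
  proof (cases "b \<in> span B")
    case True
    then have "?W = span B"
      by (rule span_redundant)
    then show ?thesis
      using IH[of x R] insert.prems by simp
  next
    case False
    have bW: "b \<in> ?W"
      by (simp add: span_base)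
    \<comment> \<open>\<open>b\<close> has positive distance from \<open>span B\<close>. Otherwise
      some \<open>b + y n\<close> tend to 0, the \<open>y n\<close> are bounded, and the induction
      hypothesis gives a subsequential limit \<open>a\<close> in \<open>span B\<close> with
      \<open>b + a = 0\<close>, which puts \<open>b\<close> into \<open>span B\<close>.\<close>
    have "\<exists>d>0. \<forall>y\<in>span B. d \<le> \<nu> (b + y)"
    proof (rule ccontr)
      assume "\<not> ?thesis"
      then have "\<forall>n. \<exists>y\<in>span B. \<nu> (b + y) < inverse (real (Suc n))"
        by (metis inverse_positive_iff_positive not_le of_nat_0_less_iff zero_less_Suc)
      then obtain y where y: "\<And>n. y n \<in> span B"
        and small: "\<And>n. \<nu> (b + y n) < inverse (real (Suc n))"
        by metis
      have yW: "y n \<in> ?W" for n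
        using y sub by auto
      have "\<nu> (y n) \<le> 1 + \<nu> b" for n
      proof -
        have "\<nu> (y n) \<le> \<nu> (b + y n) + \<nu> (- b)"
          using tri[of "b + y n" "- b"] yW bW by (simp add: span_add span_neg)
        moreover have "inverse (real (Suc n)) \<le> 1"
          by (simp add: field_simps)
        ultimately show ?thesis
          using small[of n] min[OF bW] by linarith
      qed
      from IH[of y, OF y this] obtain a r where a: "a \<in> span B" and r: "strict_mono r"
        and lim: "(\<lambda>n. \<nu> (y (r n) - a)) \<longlonglongrightarrow> 0"
        by auto
      have aW: "a \<in> ?W"
        using a sub by auto
      have "\<nu> (b + a) \<le> inverse (real (Suc (r n))) + \<nu> (y (r n) - a)" for n
      proof -
        have "\<nu> (b + a) \<le> \<nu> (b + y (r n)) + \<nu> (- (y (r n) - a))"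
          using tri[of "b + y (r n)" "- (y (r n) - a)"] yW[of "r n"] bW aW
          by (simp add: span_add span_neg span_diff)
        then show ?thesis
          using small[of "r n"] min[of "y (r n) - a"] yW[of "r n"] aW
          by (simp add: span_diff)
      qed
      moreover have "(\<lambda>n. inverse (real (Suc (r n))) + \<nu> (y (r n) - a)) \<longlonglongrightarrow> 0 + 0"
        using LIMSEQ_subseq_LIMSEQ[OF LIMSEQ_inverse_real_of_nat r] lim
        by (intro tendsto_add) (simp_all add: o_def)
      ultimately have "\<nu> (b + a) \<le> 0"
        by (intro LIMSEQ_le_const[where X = "\<lambda>n. inverse (real (Suc (r n))) + \<nu> (y (r n) - a)"]) auto
      then have "b + a = 0"
        using nonneg[of "b + a"] norm_on_eq_0[OF norm, of "b + a"] bW aW by (simp add: span_add)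
      then show False
        using False a by (metis add_eq_0_iff2 span_neg)
    qed
    then obtain d where d: "d > 0" and sep: "\<And>y. y \<in> span B \<Longrightarrow> d \<le> \<nu> (b + y)"
      by auto
    \<comment> \<open>Split each \<open>x n\<close> into its coordinate along \<open>b\<close> and a
      remainder in \<open>span B\<close>; convergent subsequences are extracted from the two
      separately.\<close>
    have "\<forall>n. \<exists>k. x n - k *\<^sub>R b \<in> span B"
      using insert.prems(2) by (simp add: span_insert)
    then obtain c where c: "\<And>n. x n - c n *\<^sub>R b \<in> span B"
      by metis
    define y where "y n = x n - c n *\<^sub>R b" for n
    have y: "y n \<in> span B" and yW: "y n \<in> ?W" for n
      using c[of n] sub by (auto simp: y_def)
    have x: "x n = c n *\<^sub>R b + y n" for n
      by (simp add: y_def)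
    \<comment> \<open>A nonzero coefficient factors out as
      \<open>x n = c n *\<^sub>R (b + z)\<close> with \<open>z\<close> in \<open>span B\<close>, so
      the distance \<open>d\<close> turns the bound on \<open>x n\<close> into one on
      \<open>c n\<close>. The case \<open>c n = 0\<close> is separate because \<open>z\<close>
      divides by \<open>c n\<close>.\<close>
    have c_bound: "\<bar>c n\<bar> \<le> R / d" for n
    proof -
      have "\<bar>c n\<bar> * d \<le> \<nu> (x n)"
      proof (cases "c n = 0")
        case True
        then show ?thesis
          using nonneg insert.prems(2) by simp
      next
        case False
        let ?z = "inverse (c n) *\<^sub>R y n"
        have z: "?z \<in> span B" "?z \<in> ?W"
          using y yW by (auto intro: span_scale)
        have "x n = c n *\<^sub>R (b + ?z)"
          using False by (simp add: x scaleR_add_right)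
        then have "\<nu> (x n) = \<bar>c n\<bar> * \<nu> (b + ?z)"
          using scale[of "b + ?z"] bW z(2) by (simp add: span_add)
        then show ?thesis
          using sep[OF z(1)] by (simp add: mult_left_mono)
      qed
      then show ?thesis
        using insert.prems(3)[of n] d by (simp add: field_simps)
    qed
    \<comment> \<open>The remainder differs from \<open>x n\<close> by a bounded multiple of
      \<open>b\<close>, so the induction hypothesis applies to it.\<close>
    have "\<nu> (y n) \<le> R + R / d * \<nu> b" for n
    proof -
      have "\<nu> (y n) \<le> \<nu> (x n) + \<nu> ((- c n) *\<^sub>R b)"
        using tri[of "x n" "(- c n) *\<^sub>R b"] insert.prems(2) bW
        by (simp add: y_def span_scale span_neg)
      also have "\<nu> ((- c n) *\<^sub>R b) = \<bar>c n\<bar> * \<nu> b"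
        using scale[OF bW, of "- c n"] by simp
      also have "\<dots> \<le> R / d * \<nu> b"
        using c_bound nonneg[OF bW] by (intro mult_right_mono)
      finally show ?thesis
        using insert.prems(3)[of n] by linarith
    qed
    from IH[of y, OF y this] obtain a r where a: "a \<in> span B" and r: "strict_mono r"
      and lim: "(\<lambda>n. \<nu> (y (r n) - a)) \<longlonglongrightarrow> 0"
      by auto
    have aW: "a \<in> ?W"
      using a sub by auto
    \<comment> \<open>Bolzano-Weierstrass for the real coefficients along \<open>r\<close>; thinning
      out further by \<open>s\<close> keeps the convergence of the remainders.\<close>
    have "bounded (range (c \<circ> r))"
      unfolding bounded_iff using c_bound by auto
    then obtain k s where s: "strict_mono s" and k: "((c \<circ> r) \<circ> s) \<longlonglongrightarrow> k"
      using bounded_imp_convergent_subsequence by blast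
    let ?q = "r \<circ> s"
    have k': "(\<lambda>n. c (?q n) - k) \<longlonglongrightarrow> 0"
      using k by (simp add: LIM_zero_iff o_def)
    have lim': "(\<lambda>n. \<nu> (y (?q n) - a)) \<longlonglongrightarrow> 0"
      using LIMSEQ_subseq_LIMSEQ[OF lim s] by (simp add: o_def)
    have upper: "(\<lambda>n. \<bar>c (?q n) - k\<bar> * \<nu> b + \<nu> (y (?q n) - a)) \<longlonglongrightarrow> 0"
      using tendsto_add[OF tendsto_mult_left_zero[OF tendsto_rabs_zero[OF k']] lim'] by simp
    have kaW: "k *\<^sub>R b + a \<in> ?W"
      using bW aW by (simp add: span_add span_scale)
    have "\<nu> (x (?q n) - (k *\<^sub>R b + a)) \<le> \<bar>c (?q n) - k\<bar> * \<nu> b + \<nu> (y (?q n) - a)" for n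
    proof -
      have "x (?q n) - (k *\<^sub>R b + a) = (c (?q n) - k) *\<^sub>R b + (y (?q n) - a)"
        by (simp add: x algebra_simps)
      also have "\<nu> \<dots> \<le> \<nu> ((c (?q n) - k) *\<^sub>R b) + \<nu> (y (?q n) - a)"
        using bW aW yW by (intro tri) (auto intro: span_diff span_scale)
      finally show ?thesis
        using scale[OF bW] by simp
    qed
    moreover have "0 \<le> \<nu> (x (?q n) - (k *\<^sub>R b + a))" for n
      using kaW insert.prems(2) by (intro nonneg span_diff)
    ultimately have "(\<lambda>n. \<nu> (x (?q n) - (k *\<^sub>R b + a))) \<longlonglongrightarrow> 0"
      by (intro tendsto_sandwich[OF _ _ tendsto_const upper]) auto
    then show ?thesis
      using kaW strict_mono_o[OF r s] by blast
  qed
qed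

text \<open>Coercivity confines the search to a closed ball, and the image of that ball under
  \<open>J\<close> is a nonempty compact set of reals, which has a least element.\<close>

lemma continuous_coercive_attains_min:
  fixes J :: "'v::real_vector \<Rightarrow> real"
  assumes "finite B" and norm: "norm_on (span B) \<nu>"
    and cont: "\<And>v e. v \<in> span B \<Longrightarrow> e > 0 \<Longrightarrow>
      \<exists>d>0. \<forall>w\<in>span B. \<nu> (w - v) < d \<longrightarrow> \<bar>J w - J v\<bar> < e"
    and coercive: "filterlim J at_top (inf (filtercomap \<nu> at_top) (principal (span B)))"
  shows "\<exists>u\<in>span B. \<forall>v\<in>span B. J u \<le> J v"
proof -
  let ?W = "span B"
  \<comment> \<open>The value at 0 serves as the level: outside radius \<open>R\<close> no point
    does better than 0.\<close>
  have "eventually (\<lambda>w. J 0 \<le> J w) (inf (filtercomap \<nu> at_top) (principal ?W))"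
    using coercive by (simp add: filterlim_at_top)
  then obtain R where R: "\<And>w. w \<in> ?W \<Longrightarrow> R \<le> \<nu> w \<Longrightarrow> J 0 \<le> J w"
    by (auto simp: eventually_inf_principal eventually_filtercomap eventually_at_top_linorder)
  \<comment> \<open>\<open>R\<close> may be negative; the maximum ensures that 0 belongs to the
    ball.\<close>
  let ?K = "{w \<in> ?W. \<nu> w \<le> max R 0}"
  have zero: "0 \<in> ?K"
    using norm_on_eq_0[OF subspace_span norm, of 0] by (simp add: span_zero)
  \<comment> \<open>Compactness is shown for the image in the reals, since the vector type itself
    carries no metric: preimages are chosen, a subsequence converges in \<open>\<nu>\<close>, and
    continuity carries this over to \<open>J\<close>.\<close>
  have "seq_compact (J ` ?K)"
    unfolding seq_compact_def
  proof (intro allI impI)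
    fix f :: "nat \<Rightarrow> real"
    assume "\<forall>n. f n \<in> J ` ?K"
    then have "\<forall>n. \<exists>w. w \<in> ?K \<and> f n = J w"
      by auto
    then obtain x where x: "\<And>n. x n \<in> ?W" "\<And>n. \<nu> (x n) \<le> max R 0" and f: "\<And>n. f n = J (x n)"
      by (auto simp: choice_iff)
    obtain a r where a: "a \<in> ?W" and r: "strict_mono r"
      and lim: "(\<lambda>n. \<nu> (x (r n) - a)) \<longlonglongrightarrow> 0"
      using norm_on_span_bounded_subseq[of B \<nu> x, OF assms(1) norm x] by auto
    \<comment> \<open>The ball is closed: letting \<open>n\<close> grow in this triangle inequality
      keeps \<open>a\<close> inside.\<close>
    have "\<nu> a \<le> \<nu> (x (r n) - a) + max R 0" for n
      using norm_on_triangle_sub[OF subspace_span norm a x(1)[of "r n"]] x(2)[of "r n"] by linarith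
    moreover have "(\<lambda>n. \<nu> (x (r n) - a) + max R 0) \<longlonglongrightarrow> 0 + max R 0"
      by (intro tendsto_add lim tendsto_const)
    ultimately have "\<nu> a \<le> 0 + max R 0"
      by (intro LIMSEQ_le_const) auto
    then have "J a \<in> J ` ?K"
      using a by simp
    moreover have "(f \<circ> r) \<longlonglongrightarrow> J a"
    proof (rule tendstoI)
      fix e :: real
      assume "e > 0"
      then obtain d where "d > 0" and d: "\<And>w. w \<in> ?W \<Longrightarrow> \<nu> (w - a) < d \<Longrightarrow> \<bar>J w - J a\<bar> < e"
        using cont[OF a] by blast
      have "\<forall>\<^sub>F n in sequentially. \<nu> (x (r n) - a) < d"
        using order_tendstoD(2)[OF lim \<open>d > 0\<close>] .
      then show "\<forall>\<^sub>F n in sequentially. dist ((f \<circ> r) n) (J a) < e"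
        by eventually_elim (simp add: f dist_real_def d x(1))
    qed
    ultimately show "\<exists>l\<in>J ` ?K. \<exists>r. strict_mono r \<and> (f \<circ> r) \<longlonglongrightarrow> l"
      using r by blast
  qed
  then have "compact (J ` ?K)"
    by (simp add: compact_eq_seq_compact_metric)
  then obtain u where u: "u \<in> ?K" and least: "\<And>w. w \<in> ?K \<Longrightarrow> J u \<le> J w"
    using compact_attains_inf[of "J ` ?K"] zero by blast
  \<comment> \<open>Inside the ball \<open>u\<close> is least; outside it, \<open>J v\<close> is at
    least \<open>J 0\<close>, hence at least \<open>J u\<close>.\<close>
  have "J u \<le> J v" if "v \<in> ?W" for v
    using least[of v] least[OF zero] R[of v] that by fastforce
  then show ?thesis
    using u by blast
qed

subsection \<open>Minimizers among ultrafunctions\<close>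

lemma span_Fpow_subset: "subspace V \<Longrightarrow> l \<in> Fpow V \<Longrightarrow> span l \<subseteq> V"
  by (simp add: Fpow_def span_minimal)

lemma continuous_coercive_findim_attains_min:
  assumes "continuous_coercive_findim V J" and "subspace V" and "l \<in> Fpow V"
  shows "\<exists>u\<in>span l. \<forall>v\<in>span l. J u \<le> J v"
proof -
  have "finite l" "span l \<subseteq> V"
    using assms by (auto simp: Fpow_def dest: span_Fpow_subset)
  moreover from this obtain \<nu> where "norm_on (span l) \<nu>"
    "\<forall>v\<in>span l. \<forall>e>0. \<exists>d>0. \<forall>w\<in>span l. \<nu> (w - v) < d \<longrightarrow> \<bar>J w - J v\<bar> < e"
    "filterlim J at_top (inf (filtercomap \<nu> at_top) (principal (span l)))"
    using assms(1) subspace_span unfolding continuous_coercive_findim_def by metis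
  ultimately show ?thesis
    by (intro continuous_coercive_attains_min) auto
qed

text \<open>Removes the ultrapower classes from the problem: every competitor is the limit of a
  family through the spans, and both the extension of \<open>J\<close> and the hyperreal order can
  be computed on representatives.\<close>

lemma is_minimizer_ultrafunctions_iff:
  assumes U: "ultrafilter_on (Fpow V) U" and V: "subspace V"
    and u: "\<And>l. l \<in> Fpow V \<Longrightarrow> u l \<in> span l"
  shows "is_minimizer (hyper_le U) (natural_ext V U J) (ultrafunctions V U)
      (Lambda_lim (Fpow V) U V u) \<longleftrightarrow>
    (\<forall>v. (\<forall>l\<in>Fpow V. v l \<in> span l) \<longrightarrow> (\<forall>\<^sub>F l in U. J (u l) \<le> J (v l)))"
proof -
  have ext: "natural_ext V U J (Lambda_lim (Fpow V) U V v) =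
      Lambda_lim (Fpow V) U UNIV (\<lambda>l. J (v l))"
    if "\<forall>l\<in>Fpow V. v l \<in> span l" for v
    using that span_Fpow_subset[OF V] by (intro natural_ext_Lambda_lim[OF U]) blast
  have "Lambda_lim (Fpow V) U V u \<in> ultrafunctions V U"
    using u by (auto simp: ultrafunctions_def)
  then have "is_minimizer (hyper_le U) (natural_ext V U J) (ultrafunctions V U)
      (Lambda_lim (Fpow V) U V u) \<longleftrightarrow>
    (\<forall>v. (\<forall>l\<in>Fpow V. v l \<in> span l) \<longrightarrow>
      hyper_le U (natural_ext V U J (Lambda_lim (Fpow V) U V u))
        (natural_ext V U J (Lambda_lim (Fpow V) U V v)))"
    unfolding is_minimizer_def ultrafunctions_def by blast
  then show ?thesis
    using u by (simp add: ext hyper_le_Lambda_lim_iff[OF U])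
qed

lemma ultrafunctions_minimizer_exists:
  assumes U: "ultrafilter_on (Fpow V) U" and V: "subspace V"
    and J: "continuous_coercive_findim V J"
  shows "\<exists>u. is_minimizer (hyper_le U) (natural_ext V U J) (ultrafunctions V U) u"
proof -
  obtain u where u: "\<And>l. l \<in> Fpow V \<Longrightarrow> u l \<in> span l"
    and least: "\<And>l v. l \<in> Fpow V \<Longrightarrow> v \<in> span l \<Longrightarrow> J (u l) \<le> J v"
    using continuous_coercive_findim_attains_min[OF J V] by metis
  have "\<forall>\<^sub>F l in U. l \<in> Fpow V"
    using U by (simp add: ultrafilter_on_def)
  \<comment> \<open>The competitor's value at \<open>l\<close> lies in the very span over which
    \<open>u l\<close> is minimal.\<close>
  then have "\<forall>\<^sub>F l in U. J (u l) \<le> J (v l)" if "\<forall>l\<in>Fpow V. v l \<in> span l" for v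
    by eventually_elim (use least that in blast)
  then show ?thesis
    using is_minimizer_ultrafunctions_iff[of V U u J] U V u by blast
qed

lemma star_embed_minimizer:
  assumes U: "fine_ultrafilter V U" and V: "subspace V" and u: "is_minimizer (\<le>) J V u"
  shows "is_minimizer (hyper_le U) (natural_ext V U J) (ultrafunctions V U) (star_embed V U u)"
proof -
  have ultra: "ultrafilter_on (Fpow V) U"
    using U by (simp add: fine_ultrafilter_def)
  have uV: "u \<in> V" and least: "\<And>v. v \<in> V \<Longrightarrow> J u \<le> J v"
    using u by (auto simp: is_minimizer_def)
  have fine: "\<forall>\<^sub>F l in U. l \<in> Fpow V \<and> {u} \<subseteq> l"
    using U uV unfolding fine_ultrafilter_def by (auto simp: Fpow_def)
  \<comment> \<open>The constant family may leave \<open>span l\<close> when \<open>u\<close> is not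
    in \<open>l\<close>. The value 0 lies in every span, and by fineness the change does not affect
    the limit.\<close>
  define u' where "u' l = (if u \<in> l then u else 0)" for l
  have u': "u' l \<in> span l" for l
    by (simp add: u'_def span_base span_zero)
  have "\<forall>\<^sub>F l in U. u = u' l"
    using fine by eventually_elim (simp add: u'_def)
  then have "star_embed V U u = Lambda_lim (Fpow V) U V u'"
    unfolding star_embed_def using uV by (subst Lambda_lim_eq_iff[OF ultra]) auto
  \<comment> \<open>Once \<open>u\<close> is in \<open>l\<close>, \<open>u' l\<close> is
    \<open>u\<close>, whose minimality over all of \<open>V\<close> covers \<open>v l\<close>
    because \<open>span l\<close> is contained in \<open>V\<close>.\<close>
  moreover have "\<forall>\<^sub>F l in U. J (u' l) \<le> J (v l)" if "\<forall>l\<in>Fpow V. v l \<in> span l" for v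
    using fine
    by eventually_elim (use least span_Fpow_subset[OF V] that in \<open>auto simp: u'_def\<close>)
  ultimately show ?thesis
    using is_minimizer_ultrafunctions_iff[OF ultra V, of u' J] u' by auto
qed

theorem theorem42:
  fixes \<Omega> :: "(real ^ 'n) set"
    and V :: "(real ^ 'n \<Rightarrow> real) set"
    and U :: "(real ^ 'n \<Rightarrow> real) set filter"
    and J :: "(real ^ 'n \<Rightarrow> real) \<Rightarrow> real"
  assumes "V \<subseteq> square_integrable_on \<Omega>"
    and "subspace V"
    and "infinite (Fpow V)"
    and "fine_ultrafilter V U"
    and "continuous_coercive_findim V J"
  shows "(\<exists>u. is_minimizer (hyper_le U) (natural_ext V U J) (ultrafunctions V U) u) \<and>
    (\<forall>u. is_minimizer (\<le>) J V u \<longrightarrow>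
      is_minimizer (hyper_le U) (natural_ext V U J) (ultrafunctions V U) (star_embed V U u))"
  using ultrafunctions_minimizer_exists[of V U J] star_embed_minimizer[of V U J] assms(2,4,5)
  by (auto simp: fine_ultrafilter_def)

end
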